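(* Let $p$ and $q$ be two primes. Let $G$ be a finite group such that $\frac{G}{Z(G)} \cong \mathbb{Z}_q \rtimes_f \mathbb{Z}_p$, the Frobenius group of order $pq$ with kernel $\mathbb{Z}_q$ and complement $\mathbb{Z}_p$, and let $x = |Z(G)|$. Then $$M_1(\mathcal{CCC}(G)) = \frac{x}{p^3}\big(q^3x^2 - 3q^2x^2 + 3qx^2 + p^6x^2 - 3p^5x^2 + 3p^4x^2 - p^3x^2 - x^2 - 2pq^2x + 4pqx - 2p^5x + 4p^4x - 2p^3x - 2px + p^2q + p^4 - p^3 - p^2\big)$$ and $$\begin{aligned} M_2(\mathcal{CCC}(G)) = \frac{x}{2p^4}\big(&q^4x^3 - 4q^3x^3 + 6q^2x^3 - 4qx^3 - p^3q - 4p^7x^3 + 6p^6x^3 - 4p^5x^3 + 3px^2 \\ &+ 3p^2q^2x - 3pq^3x^2 + 9pq^2x^2 - 9pqx^2 - 3p^7x^2 + 9p^6x^2 - 9p^5x^2 + 3p^4x^2 \\ &+ p^4x^3 - 6p^2qx + 3p^6x - 6p^5x + 3p^4x + 3p^2x + x^3 + p^8x^3 - p^5 + p^4 + p^3\big). \end{aligned}$$ Further, $\frac{M_2(\mathcal{CCC}(G))}{|e(\mathcal{CCC}(G))|} \geq \frac{M_1(\mathcal{CCC}(G))}{|v(\mathcal{CCC}(G))|}$.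
   Context: $Z(G)$ denotes the center of $G$. For a finite group $G$ and $x \in G$, $x^G$ denotes the conjugacy class of $x$ in $G$. The commuting conjugacy class graph $\mathcal{CCC}(G)$ is the simple undirected graph whose vertices are the conjugacy classes of non-central elements of $G$, where two distinct vertices $x^G$ and $y^G$ are adjacent if and only if there exist $x' \in x^G$ and $y' \in y^G$ with $x'y' = y'x'$. For a finite simple graph $\Gamma$ with vertex set $v(\Gamma)$ and edge set $e(\Gamma)$, the first and second Zagreb indices are $M_1(\Gamma) = \sum_{v \in v(\Gamma)} \deg(v)^2$ and $M_2(\Gamma) = \sum_{uv \in e(\Gamma)} \deg(u)\deg(v)$. Convention: if $\Gamma$ has no edges (so $M_1(\Gamma)=M_2(\Gamma)=0$), the quotient $M_2(\Gamma)/|e(\Gamma)|$ is read as $0$. *)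

theory Defs
  imports
    Complex_Main
    "HOL-Computational_Algebra.Primes"
    "HOL-Algebra.Algebra"
begin

hide_const (open) Divisibility.prime

section \<open>Groups\<close>

definition center :: "('a, 'b) monoid_scheme \<Rightarrow> 'a set"
  where "center G = {z \<in> carrier G. \<forall>g \<in> carrier G. z \<otimes>\<^bsub>G\<^esub> g = g \<otimes>\<^bsub>G\<^esub> z}"

definition conj_class :: "('a, 'b) monoid_scheme \<Rightarrow> 'a \<Rightarrow> 'a set"
  where "conj_class G x = {g \<otimes>\<^bsub>G\<^esub> x \<otimes>\<^bsub>G\<^esub> inv\<^bsub>G\<^esub> g | g. g \<in> carrier G}"

definition semidirect ::
    "('n, 'c) monoid_scheme \<Rightarrow> ('h, 'd) monoid_scheme \<Rightarrow> ('h \<Rightarrow> 'n \<Rightarrow> 'n) \<Rightarrow> ('n \<times> 'h) monoid"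
  where "semidirect N H f =
    \<lparr>carrier = carrier N \<times> carrier H,
     monoid.mult = \<lambda>(n, h) (n', h'). (n \<otimes>\<^bsub>N\<^esub> f h n', h \<otimes>\<^bsub>H\<^esub> h'),
     one = (\<one>\<^bsub>N\<^esub>, \<one>\<^bsub>H\<^esub>)\<rparr>"

text \<open>
  A Frobenius complement is a nontrivial proper subgroup that meets its conjugates by
  elements outside it trivially; the kernel consists of the identity and of all
  elements that lie in no conjugate of the complement.
\<close>

definition frobenius_group :: "('a, 'b) monoid_scheme \<Rightarrow> 'a set \<Rightarrow> 'a set \<Rightarrow> bool"
  where "frobenius_group F K H \<longleftrightarrow>
    group F \<and> finite (carrier F) \<and>
    subgroup H F \<and> H \<noteq> {\<one>\<^bsub>F\<^esub>} \<and> H \<noteq> carrier F \<and>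
    (\<forall>g \<in> carrier F - H. H \<inter> (\<lambda>h. g \<otimes>\<^bsub>F\<^esub> h \<otimes>\<^bsub>F\<^esub> inv\<^bsub>F\<^esub> g) ` H = {\<one>\<^bsub>F\<^esub>}) \<and>
    K = insert \<one>\<^bsub>F\<^esub>
      (carrier F - (\<Union>g \<in> carrier F. (\<lambda>h. g \<otimes>\<^bsub>F\<^esub> h \<otimes>\<^bsub>F\<^esub> inv\<^bsub>F\<^esub> g) ` H))"

section \<open>Finite simple graphs and Zagreb indices\<close>

text \<open>An undirected edge is the two-element set of its endpoints.\<close>

record 'v sgraph =
  vertices :: "'v set"
  edges :: "'v set set"

definition finite_simple_graph :: "'v sgraph \<Rightarrow> bool"
  where "finite_simple_graph \<Gamma> \<longleftrightarrow>
    finite (vertices \<Gamma>) \<and> (\<forall>e \<in> edges \<Gamma>. e \<subseteq> vertices \<Gamma> \<and> card e = 2)"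

definition vdeg :: "'v sgraph \<Rightarrow> 'v \<Rightarrow> nat"
  where "vdeg \<Gamma> v = card {e \<in> edges \<Gamma>. v \<in> e}"

definition zagreb1 :: "'v sgraph \<Rightarrow> nat"
  where "zagreb1 \<Gamma> = (\<Sum>v \<in> vertices \<Gamma>. (vdeg \<Gamma> v)\<^sup>2)"

definition zagreb2 :: "'v sgraph \<Rightarrow> nat"
  where "zagreb2 \<Gamma> = (\<Sum>e \<in> edges \<Gamma>. \<Prod>v \<in> e. vdeg \<Gamma> v)"

section \<open>The commuting conjugacy class graph\<close>

definition CCC :: "('a, 'b) monoid_scheme \<Rightarrow> 'a set sgraph"
  where "CCC G =
    \<lparr>vertices = {conj_class G x | x. x \<in> carrier G - center G},
     edges = {{conj_class G x, conj_class G y} | x y.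
       x \<in> carrier G - center G \<and> y \<in> carrier G - center G \<and>
       conj_class G x \<noteq> conj_class G y \<and>
       (\<exists>x' \<in> conj_class G x. \<exists>y' \<in> conj_class G y. x' \<otimes>\<^bsub>G\<^esub> y' = y' \<otimes>\<^bsub>G\<^esub> x')}\<rparr>"

lemma finite_simple_graph_CCC:
  assumes "finite (carrier G)"
  shows "finite_simple_graph (CCC G)"
  unfolding finite_simple_graph_def
proof (intro conjI ballI)
  have "vertices (CCC G) = conj_class G ` (carrier G - center G)"
    by (auto simp: CCC_def)
  then show "finite (vertices (CCC G))"
    using assms by simp
next
  fix e assume "e \<in> edges (CCC G)"
  then obtain x y where e: "e = {conj_class G x, conj_class G y}"
      "x \<in> carrier G - center G" "y \<in> carrier G - center G" "conj_class G x \<noteq> conj_class G y"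
    unfolding CCC_def sgraph.simps mem_Collect_eq by metis
  show "e \<subseteq> vertices (CCC G)"
    using e(1-3) by (auto simp: CCC_def)
  show "card e = 2"
    using e(4) by (simp only: e(1) card_2_iff) blast
qed

lemma group_semidirect:
  assumes "group N" "group H" and f: "f \<in> hom H (AutoGroup N)"
  shows "group (semidirect N H f)"
proof -
  interpret N: group N by fact
  interpret H: group H by fact
  have au: "f h \<in> auto N" if "h \<in> carrier H" for h
    using f that by (auto simp: hom_def AutoGroup_def)
  have cl: "f h n \<in> carrier N" if "h \<in> carrier H" "n \<in> carrier N" for h n
    using au[OF that(1)] that(2) by (auto simp: auto_def hom_def)
  have mu: "f h (n \<otimes>\<^bsub>N\<^esub> m) = f h n \<otimes>\<^bsub>N\<^esub> f h m"
    if "h \<in> carrier H" "n \<in> carrier N" "m \<in> carrier N" for h n m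
    using au[OF that(1)] that(2,3) by (auto simp: auto_def hom_def)
  have co: "f (h \<otimes>\<^bsub>H\<^esub> k) n = f h (f k n)"
    if "h \<in> carrier H" "k \<in> carrier H" "n \<in> carrier N" for h k n
  proof -
    have "f (h \<otimes>\<^bsub>H\<^esub> k) = compose (carrier N) (f h) (f k)"
      using f au that by (auto simp: hom_def AutoGroup_def BijGroup_def auto_def)
    then show ?thesis using that by (simp add: compose_def)
  qed
  have on: "f \<one>\<^bsub>H\<^esub> n = n" if "n \<in> carrier N" for n
  proof -
    have "bij_betw (f \<one>\<^bsub>H\<^esub>) (carrier N) (carrier N)"
      using au[of "\<one>\<^bsub>H\<^esub>"] by (auto simp: auto_def Bij_def)
    moreover have "f \<one>\<^bsub>H\<^esub> (f \<one>\<^bsub>H\<^esub> n) = f \<one>\<^bsub>H\<^esub> n"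
      using co[of "\<one>\<^bsub>H\<^esub>" "\<one>\<^bsub>H\<^esub>" n] that by simp
    ultimately show ?thesis
      using that cl[of "\<one>\<^bsub>H\<^esub>" n] by (auto simp: bij_betw_def dest: inj_onD)
  qed
  show ?thesis
  proof (rule groupI)
    fix x assume "x \<in> carrier (semidirect N H f)"
    then obtain n h where x: "x = (n, h)" "n \<in> carrier N" "h \<in> carrier H"
      by (auto simp: semidirect_def)
    let ?y = "(f (inv\<^bsub>H\<^esub> h) (inv\<^bsub>N\<^esub> n), inv\<^bsub>H\<^esub> h)"
    have "f (inv\<^bsub>H\<^esub> h) (inv\<^bsub>N\<^esub> n) \<otimes>\<^bsub>N\<^esub> f (inv\<^bsub>H\<^esub> h) n = f (inv\<^bsub>H\<^esub> h) \<one>\<^bsub>N\<^esub>"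
      using x mu[of "inv\<^bsub>H\<^esub> h" "inv\<^bsub>N\<^esub> n" n] by simp
    also have "\<dots> = \<one>\<^bsub>N\<^esub>"
      using x cl mu[of "inv\<^bsub>H\<^esub> h" "\<one>\<^bsub>N\<^esub>" "\<one>\<^bsub>N\<^esub>"] by (simp add: N.l_cancel_one')
    finally show "\<exists>y\<in>carrier (semidirect N H f). y \<otimes>\<^bsub>semidirect N H f\<^esub> x = \<one>\<^bsub>semidirect N H f\<^esub>"
      using x cl by (intro bexI[of _ ?y]) (auto simp: semidirect_def)
  qed (auto simp: semidirect_def cl mu co on N.m_assoc H.m_assoc)
qed

end

theory Submission
  imports Defs
begin

text \<open>Let \<open>\<pi>\<close> be the projection of \<open>G\<close> onto the Frobenius group \<open>G / Z(G)\<close> with kernel \<open>K\<close> and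
  complement \<open>L\<close>. Both \<open>K\<close> and \<open>L\<close> have prime order and contain the centralizers of their
  nontrivial elements, so the centralizer of a noncentral element over \<open>K\<close> (or \<open>L\<close>) is the
  whole preimage of \<open>K\<close> (or \<open>L\<close>). Every element not over \<open>K\<close> is conjugate to one over \<open>L\<close>.
  Hence the classes over \<open>K\<close> have size \<open>p\<close>, the others have size \<open>q\<close>, and the graph is the
  disjoint union of complete graphs on \<open>x (q - 1) / p\<close> and \<open>x (p - 1)\<close> vertices.\<close>

section \<open>Disjoint unions of two cliques\<close>

text \<open>The edge set of the complete graph on \<open>V\<close>, in the encoding of edges as
  two-element sets.\<close>

definition two_subsets :: "'v set \<Rightarrow> 'v set set"
  where "two_subsets V = {e. e \<subseteq> V \<and> card e = 2}"

lemma finite_two_subsets: "finite V \<Longrightarrow> finite (two_subsets V)"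
  by (simp add: two_subsets_def)

text \<open>Doubling and passing to the reals avoids both the division by two and the truncated
  subtraction, so the identity also covers an empty \<open>V\<close>.\<close>

lemma card_two_subsets:
  assumes "finite V"
  shows "2 * real (card (two_subsets V)) = real (card V) * (real (card V) - 1)"
proof -
  have "card (two_subsets V) = card V choose 2"
    unfolding two_subsets_def by (rule n_subsets[OF assms])
  then have "2 * card (two_subsets V) = card V * (card V - 1)"
    by (cases "card V") (simp_all add: choose_two)
  then have "2 * real (card (two_subsets V)) = real (card V * (card V - 1))"
    by (metis of_nat_mult of_nat_numeral)
  then show ?thesis
    by (cases "card V") (auto simp: algebra_simps)
qed

lemma card_two_subsets_containing:
  assumes "finite V" "v \<in> V"
  shows "card {e \<in> two_subsets V. v \<in> e} = card V - 1"
proof -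
  have "{e \<in> two_subsets V. v \<in> e} = (\<lambda>w. {v, w}) ` (V - {v})"
    using assms(2) by (auto simp: two_subsets_def card_2_iff doubleton_eq_iff)
  moreover have "inj_on (\<lambda>w. {v, w}) (V - {v})"
    by (auto simp: inj_on_def doubleton_eq_iff)
  ultimately show ?thesis
    using assms by (simp add: card_image)
qed

locale two_cliques =
  fixes \<Gamma> :: "'v sgraph" and V W :: "'v set"
  assumes finite_V: "finite V" and finite_W: "finite W" and disjoint: "V \<inter> W = {}"
    and vertices: "vertices \<Gamma> = V \<union> W"
    and edges: "edges \<Gamma> = two_subsets V \<union> two_subsets W"
begin

text \<open>The two cliques play symmetric roles, so every fact shown for \<open>V\<close> transfers
  to \<open>W\<close>.\<close>

lemma swap: "two_cliques \<Gamma> W V"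
  using finite_V finite_W disjoint vertices edges by unfold_locales auto

lemma vdeg_left:
  assumes "v \<in> V"
  shows "vdeg \<Gamma> v = card V - 1"
proof -
  have "{e \<in> edges \<Gamma>. v \<in> e} = {e \<in> two_subsets V. v \<in> e}"
    using assms disjoint by (auto simp: edges two_subsets_def)
  then show ?thesis
    using card_two_subsets_containing[OF finite_V assms] by (simp add: vdeg_def)
qed

lemma disjoint_two_subsets: "two_subsets V \<inter> two_subsets W = {}"
proof (rule ccontr)
  assume "two_subsets V \<inter> two_subsets W \<noteq> {}"
  then obtain e where e: "e \<subseteq> V" "e \<subseteq> W" "card e = 2"
    by (auto simp: two_subsets_def)
  then have "e = {}"
    using disjoint by blast
  with e(3) show False
    by simp
qed

lemma card_vertices: "card (vertices \<Gamma>) = card V + card W"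
  by (simp add: vertices card_Un_disjoint finite_V finite_W disjoint)

lemma card_edges:
  "2 * real (card (edges \<Gamma>)) =
    real (card V) * (real (card V) - 1) + real (card W) * (real (card W) - 1)"
  using card_two_subsets[OF finite_V] card_two_subsets[OF finite_W]
  by (simp add: edges card_Un_disjoint finite_two_subsets finite_V finite_W disjoint_two_subsets)

lemma sum_vdeg_left: "(\<Sum>v\<in>V. real (vdeg \<Gamma> v) ^ 2) = real (card V) * (real (card V) - 1) ^ 2"
  \<comment> \<open>The degree is a truncated difference. It agrees with the real
    \<open>card V - 1\<close> unless \<open>V\<close> is empty, where both sides vanish.\<close>
  by (cases "card V") (simp_all add: vdeg_left)

text \<open>Every edge contributes the square of the common degree, and the number of edges supplies
  the remaining factors.\<close>

lemma sum_edges_left: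
  "2 * (\<Sum>e\<in>two_subsets V. \<Prod>v\<in>e. real (vdeg \<Gamma> v)) = real (card V) * (real (card V) - 1) ^ 3"
proof (cases "card V")
  case 0
  then have "two_subsets V = {}"
    using finite_V by (auto simp: two_subsets_def)
  then show ?thesis
    using 0 by simp
next
  case (Suc n)
  have "(\<Prod>v\<in>e. real (vdeg \<Gamma> v)) = (real (card V) - 1) ^ 2" if "e \<in> two_subsets V" for e
  proof -
    have "(\<Prod>v\<in>e. real (vdeg \<Gamma> v)) = (\<Prod>v\<in>e. real (card V) - 1)"
      using that Suc by (intro prod.cong) (auto simp: two_subsets_def vdeg_left)
    then show ?thesis
      using that by (simp add: two_subsets_def)
  qed
  then have "2 * (\<Sum>e\<in>two_subsets V. \<Prod>v\<in>e. real (vdeg \<Gamma> v))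
      = (2 * real (card (two_subsets V))) * (real (card V) - 1) ^ 2"
    by simp
  then show ?thesis
    by (simp only: card_two_subsets[OF finite_V]) (simp add: power2_eq_square power3_eq_cube)
qed

lemma zagreb1:
  "real (zagreb1 \<Gamma>) =
    real (card V) * (real (card V) - 1) ^ 2 + real (card W) * (real (card W) - 1) ^ 2"
  using sum_vdeg_left two_cliques.sum_vdeg_left[OF swap]
  by (simp add: zagreb1_def vertices sum.union_disjoint finite_V finite_W disjoint)

lemma zagreb2:
  "2 * real (zagreb2 \<Gamma>) =
    real (card V) * (real (card V) - 1) ^ 3 + real (card W) * (real (card W) - 1) ^ 3"
  using sum_edges_left two_cliques.sum_edges_left[OF swap]
  by (simp add: zagreb2_def edges sum.union_disjoint finite_two_subsets finite_V finite_W
      disjoint_two_subsets)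

text \<open>With \<open>u = card V - 1\<close> and \<open>w = card W - 1\<close>, clearing denominators leaves a multiple of
  \<open>(u + w) * (u - w)\<^sup>2\<close>.\<close>

lemma zagreb_quotients:
  assumes "V \<noteq> {}" "W \<noteq> {}"
  shows "real (zagreb1 \<Gamma>) / real (card (vertices \<Gamma>)) \<le> real (zagreb2 \<Gamma>) / real (card (edges \<Gamma>))"
proof -
  define u w where "u = real (card V) - 1" and "w = real (card W) - 1"
  have "card V \<ge> 1" "card W \<ge> 1"
    using assms finite_V finite_W by (auto simp: Suc_le_eq card_gt_0_iff)
  then have uw: "0 \<le> u" "0 \<le> w"
    by (simp_all add: u_def w_def)
  have cards: "real (card V) = u + 1" "real (card W) = w + 1"
    by (simp_all add: u_def w_def)
  have v: "real (card (vertices \<Gamma>)) = u + w + 2"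
    by (simp add: card_vertices cards)
  have e: "2 * real (card (edges \<Gamma>)) = (u + 1) * u + (w + 1) * w"
    by (simp add: card_edges cards)
  have m1: "real (zagreb1 \<Gamma>) = (u + 1) * u ^ 2 + (w + 1) * w ^ 2"
    by (simp add: zagreb1 cards)
  have m2: "2 * real (zagreb2 \<Gamma>) = (u + 1) * u ^ 3 + (w + 1) * w ^ 3"
    by (simp add: zagreb2 cards)
  have "0 \<le> (u + 1) * (w + 1) * ((u + w) * (u - w) ^ 2)"
    using uw by simp
  also have "\<dots> = ((u + 1) * u ^ 3 + (w + 1) * w ^ 3) * (u + w + 2)
      - ((u + 1) * u ^ 2 + (w + 1) * w ^ 2) * ((u + 1) * u + (w + 1) * w)"
    by (simp add: power2_eq_square power3_eq_cube algebra_simps)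
  finally have cross: "real (zagreb1 \<Gamma>) * (2 * real (card (edges \<Gamma>)))
      \<le> 2 * real (zagreb2 \<Gamma>) * real (card (vertices \<Gamma>))"
    by (simp only: v e m1 m2)
  show ?thesis
  proof (cases "card (edges \<Gamma>) = 0")
    \<comment> \<open>Division by zero yields 0, in agreement with the convention for edgeless
      graphs. Both cliques are then single vertices, so \<open>zagreb1 \<Gamma>\<close> vanishes as
      well.\<close>
    case True
    then have "(u + 1) * u + (w + 1) * w = 0"
      using e by simp
    then have "(u + 1) * u = 0" "(w + 1) * w = 0"
      using uw by (simp_all add: add_nonneg_eq_0_iff)
    then have "u = 0" "w = 0"
      using uw by auto
    then show ?thesis
      using m1 by simp
  next
    case False
    have "0 < u + w + 2"
      using uw by simp
    then show ?thesis
      using cross False by (simp add: frac_le_eq v divide_simps mult.commute)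
  qed
qed

end

section \<open>Conjugacy classes\<close>

context group
begin

text \<open>Makes the orbit-stabilizer theorem and the disjointness of orbits available for
  conjugacy classes.\<close>

lemma conj_class_eq_orbit:
  "a \<in> carrier G \<Longrightarrow>
    conj_class G a = orbit G (\<lambda>g. \<lambda>h\<in>carrier G. g \<otimes> h \<otimes> inv g) a"
  by (auto simp: conj_class_def orbit_def)

lemma conj_class_subset: "a \<in> carrier G \<Longrightarrow> conj_class G a \<subseteq> carrier G"
  by (auto simp: conj_class_def)

lemma conj_class_refl: "a \<in> carrier G \<Longrightarrow> a \<in> conj_class G a"
  using group_action.orbit_refl[OF action_by_conjugation] by (simp add: conj_class_eq_orbit)

lemma conj_class_eq:
  assumes "a \<in> carrier G" "b \<in> conj_class G a"
  shows "conj_class G b = conj_class G a"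
proof -
  have b: "b \<in> carrier G"
    using assms conj_class_subset by blast
  let ?\<phi> = "\<lambda>g. \<lambda>h\<in>carrier G. g \<otimes> h \<otimes> inv g"
  have "orbit G ?\<phi> b \<in> orbits G (carrier G) ?\<phi>" "orbit G ?\<phi> a \<in> orbits G (carrier G) ?\<phi>"
    using assms(1) b by (auto simp: orbits_def)
  moreover have "b \<in> orbit G ?\<phi> b \<inter> orbit G ?\<phi> a"
    using conj_class_refl[OF b] assms b by (simp add: conj_class_eq_orbit)
  ultimately have "orbit G ?\<phi> b = orbit G ?\<phi> a"
    using group_action.disjoint_union[OF action_by_conjugation] by blast
  then show ?thesis
    using assms(1) b by (simp add: conj_class_eq_orbit)
qed

text \<open>Orbit-stabilizer for the conjugation action, whose stabilizers are the
  centralizers.\<close>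

lemma card_conj_class:
  assumes "a \<in> carrier G"
  shows "card (conj_class G a) * card {g \<in> carrier G. g \<otimes> a = a \<otimes> g} = order G"
proof -
  have "g \<otimes> a \<otimes> inv g = a \<longleftrightarrow> g \<otimes> a = a \<otimes> g" if "g \<in> carrier G" for g
    using that assms by (metis inv_closed inv_solve_right m_closed)
  then have "stabilizer G (\<lambda>g. \<lambda>h\<in>carrier G. g \<otimes> h \<otimes> inv g) a
      = {g \<in> carrier G. g \<otimes> a = a \<otimes> g}"
    using assms by (auto simp: stabilizer_def)
  then show ?thesis
    using group_action.orbit_stabilizer_theorem[OF action_by_conjugation assms] assms
    by (simp add: conj_class_eq_orbit)
qed

text \<open>A conjugation-invariant set is partitioned by the classes it contains, here all of the
  same size \<open>k\<close>.\<close>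

lemma card_conj_classes:
  assumes "finite S" "S \<subseteq> carrier G" "\<And>a. a \<in> S \<Longrightarrow> conj_class G a \<subseteq> S"
    and "\<And>a. a \<in> S \<Longrightarrow> card (conj_class G a) = k"
  shows "k * card (conj_class G ` S) = card S"
proof -
  have S: "\<Union>(conj_class G ` S) = S"
    using assms(2,3) conj_class_refl by blast
  have "k * card (conj_class G ` S) = card (\<Union>(conj_class G ` S))"
  proof (rule card_partition)
    fix c d assume "c \<in> conj_class G ` S" "d \<in> conj_class G ` S" "c \<noteq> d"
    then obtain a b where "a \<in> carrier G" "c = conj_class G a" "b \<in> carrier G" "d = conj_class G b"
      using assms(2) by blast
    with \<open>c \<noteq> d\<close> show "c \<inter> d = {}"
      using conj_class_eq by blast
  next
    show "finite (\<Union>(conj_class G ` S))"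
      using assms(1) by (simp only: S)
  qed (use assms(1,4) in auto)
  then show ?thesis
    by (simp only: S)
qed

text \<open>Serves, together with \<open>commute_mult\<close>, the closure proofs for both
  centralizers and the center.\<close>

lemma commute_inv:
  assumes "g \<in> carrier G" "a \<in> carrier G" "g \<otimes> a = a \<otimes> g"
  shows "inv g \<otimes> a = a \<otimes> inv g"
proof -
  have "inv g \<otimes> a \<otimes> g = a"
    using assms inv_solve_left[of a g "a \<otimes> g"] by (simp add: m_assoc)
  then show ?thesis
    using assms by (simp add: inv_solve_right)
qed

lemma commute_mult:
  assumes "g \<in> carrier G" "k \<in> carrier G" "a \<in> carrier G" "g \<otimes> a = a \<otimes> g" "k \<otimes> a = a \<otimes> k"
  shows "g \<otimes> k \<otimes> a = a \<otimes> (g \<otimes> k)"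
proof -
  have "g \<otimes> k \<otimes> a = g \<otimes> a \<otimes> k"
    using assms(1-3,5) by (simp add: m_assoc)
  then show ?thesis
    using assms(1-4) by (simp add: m_assoc)
qed

lemma subgroup_centralizer:
  assumes "a \<in> carrier G"
  shows "subgroup {g \<in> carrier G. g \<otimes> a = a \<otimes> g} G"
proof (rule subgroupI)
  have "\<one> \<in> {g \<in> carrier G. g \<otimes> a = a \<otimes> g}"
    using assms by simp
  then show "{g \<in> carrier G. g \<otimes> a = a \<otimes> g} \<noteq> {}"
    by blast
next
  fix g assume "g \<in> {g \<in> carrier G. g \<otimes> a = a \<otimes> g}"
  then show "inv g \<in> {g \<in> carrier G. g \<otimes> a = a \<otimes> g}"
    using commute_inv assms inv_closed by blast
next
  fix g k assume "g \<in> {g \<in> carrier G. g \<otimes> a = a \<otimes> g}" "k \<in> {g \<in> carrier G. g \<otimes> a = a \<otimes> g}"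
  then show "g \<otimes> k \<in> {g \<in> carrier G. g \<otimes> a = a \<otimes> g}"
    using commute_mult assms m_closed by blast
qed blast

lemma normal_center: "center G \<lhd> G"
proof -
  have "subgroup (center G) G"
  proof (rule subgroupI)
    have "\<one> \<in> center G"
      by (simp add: center_def)
    then show "center G \<noteq> {}"
      by blast
  next
    fix a assume "a \<in> center G"
    then show "inv a \<in> center G"
      unfolding center_def using commute_inv inv_closed by blast
  next
    fix a b assume "a \<in> center G" "b \<in> center G"
    then show "a \<otimes> b \<in> center G"
      unfolding center_def using commute_mult m_closed by blast
  qed (auto simp: center_def)
  moreover have "g \<otimes> z \<otimes> inv g = z" if "g \<in> carrier G" "z \<in> center G" for g z
  proof -
    have "g \<otimes> z = z \<otimes> g" "z \<in> carrier G"
      using that by (auto simp: center_def)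
    then show ?thesis
      using that(1) by (simp add: m_assoc)
  qed
  ultimately show ?thesis
    unfolding normal_inv_iff by simp
qed

text \<open>By Lagrange inside \<open>L\<close>, the order of \<open>M\<close> divides a prime, and
  \<open>u\<close> prevents it from being 1.\<close>

lemma subgroup_eq_of_prime_card:
  assumes "subgroup L G" "subgroup M G" "M \<subseteq> L" "prime (card L)" "u \<in> M" "u \<noteq> \<one>"
  shows "M = L"
proof -
  have L: "finite L"
    using assms(4) card_ge_0_finite prime_gt_0_nat by blast
  interpret L: group "G\<lparr>carrier := L\<rparr>"
    using assms(1) by (rule subgroup_imp_group)
  have "subgroup M (G\<lparr>carrier := L\<rparr>)"
    by (rule subgroup_incl[OF assms(2,1,3)])
  then have "card M dvd card L"
    using L.lagrange[of M] by (simp add: order_def) (metis dvd_triv_right)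
  moreover have "card M \<noteq> 1"
    using assms(5,6) subgroup.one_closed[OF assms(2)] by (auto simp: card_1_singleton_iff)
  ultimately have "card M = card L"
    using assms(4) by (auto simp: prime_nat_iff)
  then show ?thesis
    using card_subset_eq[OF L assms(3)] by simp
qed

end

section \<open>Centralizers modulo the center\<close>

text \<open>The property common to Frobenius complements and normal Frobenius kernels; it lets one
  argument compute the centralizers over both.\<close>

definition contains_centralizers :: "('a, 'b) monoid_scheme \<Rightarrow> 'a set \<Rightarrow> bool"
  where "contains_centralizers F L \<longleftrightarrow>
    (\<forall>u \<in> L - {\<one>\<^bsub>F\<^esub>}. \<forall>v \<in> carrier F. v \<otimes>\<^bsub>F\<^esub> u = u \<otimes>\<^bsub>F\<^esub> v \<longrightarrow> v \<in> L)"

lemma contains_centralizersD: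
  assumes "contains_centralizers F L" "u \<in> L" "u \<noteq> \<one>\<^bsub>F\<^esub>" "v \<in> carrier F"
    and "v \<otimes>\<^bsub>F\<^esub> u = u \<otimes>\<^bsub>F\<^esub> v"
  shows "v \<in> L"
  using assms unfolding contains_centralizers_def by blast

context group_hom
begin

text \<open>The fibre through \<open>g\<close> is a right coset of the kernel, and all cosets are
  equipotent.\<close>

lemma card_fibre:
  assumes "g \<in> carrier G"
  shows "card {a \<in> carrier G. h a = h g} = card (kernel G H h)"
proof -
  have "{a \<in> carrier G. h a = h g} = kernel G H h #> g"
  proof (intro subset_antisym subsetI)
    fix a assume "a \<in> {a \<in> carrier G. h a = h g}"
    then have "a \<otimes> inv g \<in> kernel G H h" "a = (a \<otimes> inv g) \<otimes> g"
      using assms by (simp_all add: kernel_def G.m_assoc)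
    then show "a \<in> kernel G H h #> g"
      unfolding r_coset_def by blast
  qed (use assms in \<open>auto simp: r_coset_def kernel_def\<close>)
  moreover have "kernel G H h #> g \<in> rcosets (kernel G H h)"
    using assms by (auto simp: RCOSETS_def)
  ultimately show ?thesis
    using G.card_rcosets_equal[of _ "kernel G H h"] subgroup.subset[OF subgroup_kernel] by metis
qed

lemma card_preimage:
  assumes "h ` carrier G = carrier H" "finite (carrier G)" "L \<subseteq> carrier H"
  shows "card {a \<in> carrier G. h a \<in> L} = card (kernel G H h) * card L"
proof -
  have fin: "finite L"
    using assms by (metis finite_imageI finite_subset)
  have "{a \<in> carrier G. h a \<in> L} = (\<Union>u\<in>L. {a \<in> carrier G. h a = u})"
    by auto
  also have "card \<dots> = (\<Sum>u\<in>L. card {a \<in> carrier G. h a = u})"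
    using assms(2) fin by (intro card_UN_disjoint) auto
  also have "\<dots> = (\<Sum>u\<in>L. card (kernel G H h))"
  proof (rule sum.cong)
    fix u assume "u \<in> L"
    then obtain g where "g \<in> carrier G" "u = h g"
      using assms(1,3) by blast
    then show "card {a \<in> carrier G. h a = u} = card (kernel G H h)"
      using card_fibre by simp
  qed simp
  finally show ?thesis
    by simp
qed

end

text \<open>Replacing the coset projection by any surjection whose kernel is the center allows
  \<open>H\<close> to be the semidirect product itself instead of the factor group.\<close>

locale central_quotient = group_hom +
  assumes finite_carrier: "finite (carrier G)"
    and surj: "h ` carrier G = carrier H"
    and kernel_eq_center: "kernel G H h = center G"
begin

lemma image_eq_one_iff: "a \<in> carrier G \<Longrightarrow> h a = \<one>\<^bsub>H\<^esub> \<longleftrightarrow> a \<in> center G"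
  using kernel_eq_center by (auto simp: kernel_def)

text \<open>The image of the centralizer of \<open>a\<close> is a nontrivial subgroup of \<open>L\<close>, hence equal to \<open>L\<close>.\<close>

lemma centralizer_eq_preimage:
  assumes L: "subgroup L H" "prime (card L)"
    and centralizing: "contains_centralizers H L"
    and a: "a \<in> carrier G" "a \<notin> center G" "h a \<in> L"
  shows "{g \<in> carrier G. g \<otimes> a = a \<otimes> g} = {g \<in> carrier G. h g \<in> L}"
proof -
  let ?C = "{g \<in> carrier G. g \<otimes> a = a \<otimes> g}"
  have ha: "h a \<noteq> \<one>\<^bsub>H\<^esub>"
    using a image_eq_one_iff by simp
  have sub: "h ` ?C \<subseteq> L"
  proof clarify
    fix g assume g: "g \<in> carrier G" "g \<otimes> a = a \<otimes> g"
    then have comm: "h g \<otimes>\<^bsub>H\<^esub> h a = h a \<otimes>\<^bsub>H\<^esub> h g"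
      using a(1) by (metis hom_mult)
    then show "h g \<in> L"
      by (rule contains_centralizersD[OF centralizing a(3) ha hom_closed[OF g(1)]])
  qed
  have "subgroup (h ` ?C) H"
    by (rule subgroup_img_is_subgroup[OF G.subgroup_centralizer[OF a(1)]])
  moreover have "h a \<in> h ` ?C"
    using a(1) by simp
  ultimately have image: "h ` ?C = L"
    using H.subgroup_eq_of_prime_card[OF L(1) _ sub L(2)] ha by blast
  have "g \<in> ?C" if g: "g \<in> carrier G" "h g \<in> L" for g
  proof -
    obtain c where c: "c \<in> ?C" "h g = h c"
      using g image by blast
    \<comment> \<open>The elements \<open>g\<close> and \<open>c\<close> differ by a central factor,
      and central elements commute with \<open>a\<close>, so \<open>g\<close> commutes with
      \<open>a\<close> because \<open>c\<close> does.\<close>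
    define z where "z = g \<otimes> inv c"
    have "z \<in> center G"
      using g c by (subst image_eq_one_iff[symmetric]) (auto simp: z_def)
    moreover have "z \<otimes> c = g"
      using g c by (simp add: z_def G.m_assoc)
    ultimately have "z \<in> ?C" "z \<otimes> c = g"
      using a(1) by (auto simp: center_def)
    then show ?thesis
      using subgroup.m_closed[OF G.subgroup_centralizer[OF a(1)], of z c] c by simp
  qed
  then show ?thesis
    using sub by auto
qed

text \<open>The centralizer of \<open>a\<close> has \<open>card (center G) * card L\<close> elements
  and the group has \<open>card (center G) * order H\<close>; the order of the center
  cancels.\<close>

lemma card_conj_class_preimage:
  assumes L: "subgroup L H" "prime (card L)"
    and centralizing: "contains_centralizers H L"
    and a: "a \<in> carrier G" "a \<notin> center G" "h a \<in> L"
  shows "card (conj_class G a) * card L = order H"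
proof -
  have sub: "L \<subseteq> carrier H"
    by (rule subgroup.subset[OF L(1)])
  have "{g \<in> carrier G. h g \<in> carrier H} = carrier G"
    by auto
  then have G: "order G = card (center G) * order H"
    using card_preimage[OF surj finite_carrier subset_refl] by (simp add: kernel_eq_center order_def)
  have "card (conj_class G a) * (card (center G) * card L) = order G"
    using G.card_conj_class[OF a(1)] card_preimage[OF surj finite_carrier sub]
    by (simp add: centralizer_eq_preimage[OF L centralizing a] kernel_eq_center)
  moreover have "card (center G) > 0"
    using G G.order_gt_0_iff_finite finite_carrier by (metis gr0I mult_0 less_not_refl)
  ultimately show ?thesis
    by (simp add: G ac_simps)
qed

end

section \<open>Frobenius groups\<close>

text \<open>If \<open>v\<close> outside \<open>H\<close> commutes with \<open>u\<close>, conjugation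
  by \<open>v\<close> fixes \<open>u\<close>, which then lies in \<open>H\<close> and in a conjugate
  meeting it trivially.\<close>

lemma frobenius_complement_centralizing:
  assumes "frobenius_group F K H"
  shows "contains_centralizers F H"
  unfolding contains_centralizers_def
proof (intro ballI impI, rule ccontr)
  interpret F: group F
    using assms by (simp add: frobenius_group_def)
  fix u v assume u: "u \<in> H - {\<one>\<^bsub>F\<^esub>}" and v: "v \<in> carrier F" "v \<otimes>\<^bsub>F\<^esub> u = u \<otimes>\<^bsub>F\<^esub> v" "v \<notin> H"
  then have "H \<inter> (\<lambda>h. v \<otimes>\<^bsub>F\<^esub> h \<otimes>\<^bsub>F\<^esub> inv\<^bsub>F\<^esub> v) ` H = {\<one>\<^bsub>F\<^esub>}"
    using assms v(1,3) by (auto simp: frobenius_group_def)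
  moreover have "u \<in> carrier F"
    using assms u subgroup.subset by (fastforce simp: frobenius_group_def)
  then have "u = v \<otimes>\<^bsub>F\<^esub> u \<otimes>\<^bsub>F\<^esub> inv\<^bsub>F\<^esub> v"
    using v(1,2) by (simp add: F.m_assoc)
  ultimately show False
    using u by blast
qed

text \<open>By definition the kernel omits only elements of conjugates of the complement. The
  conjugation is moved over to \<open>v\<close> so that it can later be lifted to
  \<open>G\<close>.\<close>

lemma frobenius_not_kernel:
  assumes "frobenius_group F K H" "v \<in> carrier F" "v \<notin> K"
  obtains g where "g \<in> carrier F" "inv\<^bsub>F\<^esub> g \<otimes>\<^bsub>F\<^esub> v \<otimes>\<^bsub>F\<^esub> g \<in> H"
proof -
  interpret F: group F
    using assms(1) by (simp add: frobenius_group_def)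
  have K: "K = insert \<one>\<^bsub>F\<^esub>
      (carrier F - (\<Union>g \<in> carrier F. (\<lambda>h. g \<otimes>\<^bsub>F\<^esub> h \<otimes>\<^bsub>F\<^esub> inv\<^bsub>F\<^esub> g) ` H))"
    using assms(1) by (simp add: frobenius_group_def)
  have "subgroup H F"
    using assms(1) by (simp add: frobenius_group_def)
  then obtain g k where "g \<in> carrier F" "k \<in> H" "k \<in> carrier F" "v = g \<otimes>\<^bsub>F\<^esub> k \<otimes>\<^bsub>F\<^esub> inv\<^bsub>F\<^esub> g"
    using assms(2,3) subgroup.subset[of H F] by (auto simp: K)
  moreover from this have "inv\<^bsub>F\<^esub> g \<otimes>\<^bsub>F\<^esub> v \<otimes>\<^bsub>F\<^esub> g = k"
    by (simp add: F.m_assoc) (simp flip: F.m_assoc)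
  ultimately show thesis
    using that by simp
qed

text \<open>The complement is its own conjugate by the identity, so its nontrivial elements are
  excluded from the kernel.\<close>

lemma frobenius_kernel_Int_complement:
  assumes "frobenius_group F K H"
  shows "K \<inter> H = {\<one>\<^bsub>F\<^esub>}"
proof -
  interpret F: group F
    using assms by (simp add: frobenius_group_def)
  have H: "subgroup H F"
    using assms by (simp add: frobenius_group_def)
  have "h \<in> (\<lambda>h. \<one>\<^bsub>F\<^esub> \<otimes>\<^bsub>F\<^esub> h \<otimes>\<^bsub>F\<^esub> inv\<^bsub>F\<^esub> \<one>\<^bsub>F\<^esub>) ` H" if "h \<in> H" for h
    using that subgroup.mem_carrier[OF H] by (auto simp: image_iff)
  then have "H \<subseteq> (\<Union>g \<in> carrier F. (\<lambda>h. g \<otimes>\<^bsub>F\<^esub> h \<otimes>\<^bsub>F\<^esub> inv\<^bsub>F\<^esub> g) ` H)"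
    using F.one_closed by blast
  moreover have "K = insert \<one>\<^bsub>F\<^esub>
      (carrier F - (\<Union>g \<in> carrier F. (\<lambda>h. g \<otimes>\<^bsub>F\<^esub> h \<otimes>\<^bsub>F\<^esub> inv\<^bsub>F\<^esub> g) ` H))"
    using assms by (simp add: frobenius_group_def)
  ultimately show ?thesis
    using subgroup.one_closed[OF H] by blast
qed

text \<open>An element outside the kernel is conjugate into the complement, so this reduces to
  the complement being self-centralizing.\<close>

lemma frobenius_kernel_centralizing:
  assumes frob: "frobenius_group F K H" and K: "K \<lhd> F"
  shows "contains_centralizers F K"
  unfolding contains_centralizers_def
proof (intro ballI impI, rule ccontr)
  interpret F: group F
    using frob by (simp add: frobenius_group_def)
  interpret K: normal K F
    by (rule K)
  fix u v assume "u \<in> K - {\<one>\<^bsub>F\<^esub>}" and v: "v \<in> carrier F" "v \<otimes>\<^bsub>F\<^esub> u = u \<otimes>\<^bsub>F\<^esub> v" "v \<notin> K"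
  then have uv: "u \<in> K" "u \<noteq> \<one>\<^bsub>F\<^esub>" "v \<in> carrier F" "v \<otimes>\<^bsub>F\<^esub> u = u \<otimes>\<^bsub>F\<^esub> v"
    by auto
  obtain g where g: "g \<in> carrier F" "inv\<^bsub>F\<^esub> g \<otimes>\<^bsub>F\<^esub> v \<otimes>\<^bsub>F\<^esub> g \<in> H"
    using frobenius_not_kernel[OF frob v(1,3)] by blast
  let ?u = "inv\<^bsub>F\<^esub> g \<otimes>\<^bsub>F\<^esub> u \<otimes>\<^bsub>F\<^esub> g" and ?v = "inv\<^bsub>F\<^esub> g \<otimes>\<^bsub>F\<^esub> v \<otimes>\<^bsub>F\<^esub> g"
  have u: "u \<in> carrier F"
    using uv(1) by simp
  \<comment> \<open>Conjugation is multiplicative, so the conjugates of the commuting elements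
    \<open>u\<close> and \<open>v\<close> commute.\<close>
  have prod: "(inv\<^bsub>F\<^esub> g \<otimes>\<^bsub>F\<^esub> a \<otimes>\<^bsub>F\<^esub> g) \<otimes>\<^bsub>F\<^esub> (inv\<^bsub>F\<^esub> g \<otimes>\<^bsub>F\<^esub> b \<otimes>\<^bsub>F\<^esub> g) = inv\<^bsub>F\<^esub> g \<otimes>\<^bsub>F\<^esub> (a \<otimes>\<^bsub>F\<^esub> b) \<otimes>\<^bsub>F\<^esub> g"
    if "a \<in> carrier F" "b \<in> carrier F" for a b
  proof -
    have "g \<otimes>\<^bsub>F\<^esub> (inv\<^bsub>F\<^esub> g \<otimes>\<^bsub>F\<^esub> c) = c" if "c \<in> carrier F" for c
      using that g(1) by (simp flip: F.m_assoc)
    then show ?thesis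
      using that g(1) by (simp add: F.m_assoc)
  qed
  have comm: "?u \<otimes>\<^bsub>F\<^esub> ?v = ?v \<otimes>\<^bsub>F\<^esub> ?u"
    by (simp only: prod[OF u uv(3)] prod[OF uv(3) u] uv(4))
  have "?v \<noteq> \<one>\<^bsub>F\<^esub>"
  proof
    assume "?v = \<one>\<^bsub>F\<^esub>"
    then have "g \<otimes>\<^bsub>F\<^esub> ?v \<otimes>\<^bsub>F\<^esub> inv\<^bsub>F\<^esub> g = \<one>\<^bsub>F\<^esub>"
      using g(1) by simp
    then have "v = \<one>\<^bsub>F\<^esub>"
      using g(1) uv(3) by (simp add: F.m_assoc) (simp flip: F.m_assoc)
    then show False
      using v(3) by simp
  qed
  \<comment> \<open>\<open>?u\<close> commutes with the nontrivial element \<open>?v\<close> of the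
    complement, hence lies there. Normality keeps \<open>?u\<close> in \<open>K\<close> too, and the
    intersection is trivial.\<close>
  then have "?u \<in> H"
    using contains_centralizersD[OF frobenius_complement_centralizing[OF frob] g(2) _ _ comm] g(1) u
    by simp
  moreover have "?u \<in> K"
    by (rule K.inv_op_closed1[OF g(1) uv(1)])
  ultimately have "?u = \<one>\<^bsub>F\<^esub>"
    using frobenius_kernel_Int_complement[OF frob] by blast
  then have "g \<otimes>\<^bsub>F\<^esub> ?u \<otimes>\<^bsub>F\<^esub> inv\<^bsub>F\<^esub> g = \<one>\<^bsub>F\<^esub>"
    using g(1) by simp
  then have "u = \<one>\<^bsub>F\<^esub>"
    using g(1) u by (simp add: F.m_assoc) (simp flip: F.m_assoc)
  then show False
    using uv(2) by simp
qed

text \<open>The first factor is the kernel of the projection to \<open>H\<close>.\<close>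

lemma normal_kernel_semidirect:
  assumes "group N" "group H" "f \<in> hom H (AutoGroup N)"
  shows "carrier N \<times> {\<one>\<^bsub>H\<^esub>} \<lhd> semidirect N H f"
proof -
  interpret group_hom "semidirect N H f" H snd
    using group_semidirect[OF assms] assms(2)
    by (auto simp: group_hom_def group_hom_axioms_def hom_def semidirect_def)
  have "kernel (semidirect N H f) H snd = carrier N \<times> {\<one>\<^bsub>H\<^esub>}"
    using monoid.one_closed[OF group.is_monoid[OF assms(2)]] by (auto simp: kernel_def semidirect_def)
  then show ?thesis
    using normal_kernel by simp
qed


section \<open>Central quotients that are Frobenius groups\<close>

text \<open>That a Frobenius kernel is a normal subgroup is Frobenius's theorem in general. Here
  normality is an assumption, which the projection of a semidirect product discharges.\<close>

locale frobenius_central_quotient = central_quotient +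
  fixes K L :: "'c set" and p q :: nat
  assumes frobenius: "frobenius_group H K L"
    and normal_K: "K \<lhd> H"
    and card_K: "card K = q" and prime_q: "prime q"
    and card_L: "card L = p" and prime_p: "prime p"
    and order_H: "order H = q * p"
begin

abbreviation inner :: "'a set"
  where "inner \<equiv> {a \<in> carrier G - center G. h a \<in> K}"

text \<open>Central elements map to the identity, which lies in \<open>K\<close>; hence members of
  \<open>outer\<close> are automatically noncentral.\<close>

abbreviation outer :: "'a set"
  where "outer \<equiv> {a \<in> carrier G. h a \<notin> K}"

lemma subgroup_K: "subgroup K H"
  using normal_K by (rule normal_imp_subgroup)

lemma subgroup_L: "subgroup L H"
  using frobenius by (simp add: frobenius_group_def)

lemma center_subset_inner: "center G \<subseteq> {a \<in> carrier G. h a \<in> K}"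
proof
  fix a assume "a \<in> center G"
  then have "a \<in> carrier G" "h a = \<one>\<^bsub>H\<^esub>"
    using image_eq_one_iff by (auto simp: center_def)
  then show "a \<in> {a \<in> carrier G. h a \<in> K}"
    using subgroup.one_closed[OF subgroup_K] by simp
qed

lemma noncentral: "carrier G - center G = inner \<union> outer"
  using center_subset_inner by auto

lemma prime_card_K: "prime (card K)"
  by (simp only: card_K prime_q)

lemma prime_card_L: "prime (card L)"
  by (simp only: card_L prime_p)

lemmas centralizer_eq_preimage_K =
  centralizer_eq_preimage[OF subgroup_K prime_card_K
    frobenius_kernel_centralizing[OF frobenius normal_K]]

lemmas centralizer_eq_preimage_L =
  centralizer_eq_preimage[OF subgroup_L prime_card_L
    frobenius_complement_centralizing[OF frobenius]]

lemmas card_conj_class_preimage_K =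
  card_conj_class_preimage[OF subgroup_K prime_card_K
    frobenius_kernel_centralizing[OF frobenius normal_K]]

lemmas card_conj_class_preimage_L =
  card_conj_class_preimage[OF subgroup_L prime_card_L
    frobenius_complement_centralizing[OF frobenius]]

text \<open>Consequently members of \<open>inner\<close> commute with one another and with no member
  of \<open>outer\<close>.\<close>

lemma commute_inner_iff:
  assumes "a \<in> inner" "b \<in> carrier G"
  shows "b \<otimes> a = a \<otimes> b \<longleftrightarrow> h b \<in> K"
proof -
  have "b \<in> {g \<in> carrier G. g \<otimes> a = a \<otimes> g} \<longleftrightarrow> b \<in> {g \<in> carrier G. h g \<in> K}"
    using assms(1) by (subst centralizer_eq_preimage_K) blast+
  then show ?thesis
    using assms(2) by blast
qed

lemma conj_class_preimage_K:
  assumes "a \<in> carrier G" "b \<in> conj_class G a"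
  shows "h b \<in> K \<longleftrightarrow> h a \<in> K"
proof -
  have "h b \<in> K" if ab: "a \<in> carrier G" "b \<in> conj_class G a" "h a \<in> K" for a b
  proof -
    obtain g where "g \<in> carrier G" "b = g \<otimes> a \<otimes> inv g"
      using ab(2) by (auto simp: conj_class_def)
    then show ?thesis
      using ab(1,3) normal.inv_op_closed2[OF normal_K, of "h g" "h a"] by simp
  qed
  \<comment> \<open>Conjugacy is symmetric, so the implication just shown also gives the
    converse.\<close>
  moreover have "a \<in> conj_class G b" "b \<in> carrier G"
    using assms G.conj_class_eq G.conj_class_refl G.conj_class_subset by blast+
  ultimately show ?thesis
    using assms by blast
qed

lemma conj_class_noncentral:
  assumes "a \<in> carrier G - center G"
  shows "conj_class G a \<subseteq> carrier G - center G"
proof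
  fix b assume b: "b \<in> conj_class G a"
  then obtain g where g: "g \<in> carrier G" "b = g \<otimes> a \<otimes> inv g"
    by (auto simp: conj_class_def)
  have "b \<notin> center G"
  proof
    assume "b \<in> center G"
    then have "b \<otimes> g = g \<otimes> b" "b \<in> carrier G"
      using g(1) by (auto simp: center_def)
    moreover have "b \<otimes> g = g \<otimes> a"
      using g assms by (simp add: G.m_assoc)
    ultimately have "a = b"
      using g(1) assms by simp
    then show False
      using \<open>b \<in> center G\<close> assms by simp
  qed
  moreover have "b \<in> carrier G"
    using b assms G.conj_class_subset by blast
  ultimately show "b \<in> carrier G - center G"
    by simp
qed

lemma conj_class_inner: "a \<in> inner \<Longrightarrow> conj_class G a \<subseteq> inner"
  using conj_class_noncentral[of a] conj_class_preimage_K[of a] by blast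

lemma conj_class_outer: "a \<in> outer \<Longrightarrow> conj_class G a \<subseteq> outer"
  using G.conj_class_subset[of a] conj_class_preimage_K[of a] by blast

lemma outer_representative:
  assumes "a \<in> outer"
  obtains b where "b \<in> conj_class G a" "b \<in> carrier G" "b \<notin> center G" "h b \<in> L"
proof -
  obtain y where y: "y \<in> carrier H" "inv\<^bsub>H\<^esub> y \<otimes>\<^bsub>H\<^esub> h a \<otimes>\<^bsub>H\<^esub> y \<in> L"
    using frobenius_not_kernel[OF frobenius, of "h a"] assms by auto
  then obtain g where g: "g \<in> carrier G" "y = h g"
    using surj by blast
  \<comment> \<open>The conjugating element of the Frobenius group lifts to \<open>g\<close> by
    surjectivity. The double inverse matches the shape required by
    \<open>conj_class\<close>.\<close>
  define b where "b = inv g \<otimes> a \<otimes> inv (inv g)"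
  have "b \<in> conj_class G a"
    using g(1) unfolding b_def conj_class_def by blast
  moreover have "h b \<in> L"
    using g y assms by (simp add: b_def)
  ultimately show thesis
    using that[of b] conj_class_outer[OF assms] noncentral by blast
qed

lemma commute_preimage_L:
  assumes "a \<in> carrier G" "a \<notin> center G" "h a \<in> L" "b \<in> carrier G" "h b \<in> L"
  shows "b \<otimes> a = a \<otimes> b"
  using assms centralizer_eq_preimage_L[OF assms(1-3)] by blast

section \<open>Sizes and numbers of conjugacy classes\<close>

lemma card_conj_class_inner:
  assumes "a \<in> inner"
  shows "card (conj_class G a) = p"
proof -
  have "card (conj_class G a) * card K = order H"
    using assms by (intro card_conj_class_preimage_K) blast+
  then show ?thesis
    using prime_gt_0_nat[OF prime_q] by (simp add: order_H card_K mult.commute)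
qed

lemma card_conj_class_outer:
  assumes "a \<in> outer"
  shows "card (conj_class G a) = q"
proof -
  obtain b where b: "b \<in> conj_class G a" "b \<in> carrier G" "b \<notin> center G" "h b \<in> L"
    using outer_representative[OF assms] .
  have "card (conj_class G b) * card L = order H"
    by (rule card_conj_class_preimage_L[OF b(2-4)])
  moreover have "conj_class G b = conj_class G a"
    using assms b(1) G.conj_class_eq by blast
  ultimately show ?thesis
    using prime_gt_0_nat[OF prime_p] by (simp add: order_H card_L)
qed

lemma card_preimage_K: "card {a \<in> carrier G. h a \<in> K} = card (center G) * q"
  using card_preimage[OF surj finite_carrier subgroup.subset[OF subgroup_K]]
  by (simp add: kernel_eq_center card_K)

lemma card_carrier: "card (carrier G) = card (center G) * (q * p)"
proof -
  have "{a \<in> carrier G. h a \<in> carrier H} = carrier G"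
    by auto
  then show ?thesis
    using card_preimage[OF surj finite_carrier subset_refl] order_H
    by (simp add: kernel_eq_center order_def)
qed

text \<open>The preimage of \<open>K\<close> has \<open>card (center G) * q\<close> elements;
  removing the center leaves a set partitioned into classes of size \<open>p\<close>.\<close>

lemma card_inner_classes: "p * card (conj_class G ` inner) = card (center G) * (q - 1)"
proof -
  have "p * card (conj_class G ` inner) = card inner"
    using finite_carrier conj_class_inner card_conj_class_inner
    by (intro G.card_conj_classes) auto
  also have "card inner = card ({a \<in> carrier G. h a \<in> K} - center G)"
    by (rule arg_cong[where f = card]) auto
  also have "\<dots> = card {a \<in> carrier G. h a \<in> K} - card (center G)"
    using finite_carrier center_subset_inner by (intro card_Diff_subset) (auto intro: finite_subset)
  finally show ?thesis
    by (simp add: card_preimage_K algebra_simps)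
qed

text \<open>The complement of the preimage of \<open>K\<close> has
  \<open>card (center G) * q * (p - 1)\<close> elements, in classes of size
  \<open>q\<close>.\<close>

lemma card_outer_classes: "card (conj_class G ` outer) = card (center G) * (p - 1)"
proof -
  have "q * card (conj_class G ` outer) = card outer"
    using finite_carrier conj_class_outer card_conj_class_outer
    by (intro G.card_conj_classes) auto
  also have "card outer = card (carrier G - {a \<in> carrier G. h a \<in> K})"
    by (rule arg_cong[where f = card]) auto
  also have "\<dots> = card (carrier G) - card {a \<in> carrier G. h a \<in> K}"
    using finite_carrier by (intro card_Diff_subset) auto
  also have "\<dots> = q * (card (center G) * (p - 1))"
    by (simp add: card_preimage_K card_carrier algebra_simps)
  finally show ?thesis
    using prime_gt_0_nat[OF prime_q] by simp
qed

section \<open>Adjacency in the commuting conjugacy class graph\<close>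

lemma commuting_inner:
  assumes "a \<in> inner" "b \<in> carrier G"
    and "\<exists>a'\<in>conj_class G a. \<exists>b'\<in>conj_class G b. a' \<otimes> b' = b' \<otimes> a'"
  shows "h b \<in> K"
proof -
  obtain a' b' where "a' \<in> conj_class G a" "b' \<in> conj_class G b" "a' \<otimes> b' = b' \<otimes> a'"
    using assms(3) by blast
  moreover from this have "a' \<in> inner" "b' \<in> carrier G"
    using conj_class_inner[OF assms(1)] G.conj_class_subset[OF assms(2)] by blast+
  ultimately show ?thesis
    using commute_inner_iff[of a' b'] conj_class_preimage_K[OF assms(2), of b'] by metis
qed

text \<open>Both classes have representatives over the same complement \<open>L\<close>, and such
  representatives commute even if \<open>a\<close> and \<open>b\<close> themselves do not.\<close>

lemma commuting_outer:
  assumes "a \<in> outer" "b \<in> outer"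
  shows "\<exists>a'\<in>conj_class G a. \<exists>b'\<in>conj_class G b. a' \<otimes> b' = b' \<otimes> a'"
  using outer_representative[OF assms(1)] outer_representative[OF assms(2)] commute_preimage_L
  by metis

lemma mem_edges_CCC:
  "e \<in> edges (CCC G) \<longleftrightarrow> (\<exists>a b. e = {conj_class G a, conj_class G b} \<and>
    a \<in> carrier G - center G \<and> b \<in> carrier G - center G \<and> conj_class G a \<noteq> conj_class G b \<and>
    (\<exists>a'\<in>conj_class G a. \<exists>b'\<in>conj_class G b. a' \<otimes> b' = b' \<otimes> a'))"
  unfolding CCC_def sgraph.simps mem_Collect_eq ..

lemma edges_CCC:
  "edges (CCC G) = two_subsets (conj_class G ` inner) \<union> two_subsets (conj_class G ` outer)"
proof (intro subset_antisym subsetI)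
  fix e assume "e \<in> edges (CCC G)"
  then obtain a b where e: "e = {conj_class G a, conj_class G b}"
    and a: "a \<in> carrier G - center G" and b: "b \<in> carrier G - center G"
    and ne: "conj_class G a \<noteq> conj_class G b"
    and comm: "\<exists>a'\<in>conj_class G a. \<exists>b'\<in>conj_class G b. a' \<otimes> b' = b' \<otimes> a'"
    unfolding mem_edges_CCC by blast
  \<comment> \<open>With the roles of \<open>a\<close> and \<open>b\<close> exchanged,
    \<open>commuting_inner\<close> applies in both directions, so no edge joins an inner class to an
    outer one.\<close>
  from comm have "\<exists>b'\<in>conj_class G b. \<exists>a'\<in>conj_class G a. b' \<otimes> a' = a' \<otimes> b'"
    by metis
  then have "h a \<in> K \<longleftrightarrow> h b \<in> K"
    using a b comm commuting_inner[of a b] commuting_inner[of b a] by blast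
  then have "(a \<in> inner \<and> b \<in> inner) \<or> (a \<in> outer \<and> b \<in> outer)"
    using a b by blast
  moreover have "card e = 2"
    using e ne by simp
  ultimately show "e \<in> two_subsets (conj_class G ` inner) \<union> two_subsets (conj_class G ` outer)"
    unfolding two_subsets_def e by blast
next
  fix e assume "e \<in> two_subsets (conj_class G ` inner) \<union> two_subsets (conj_class G ` outer)"
  then consider (inner) "e \<subseteq> conj_class G ` inner" "card e = 2"
    | (outer) "e \<subseteq> conj_class G ` outer" "card e = 2"
    unfolding two_subsets_def by blast
  then show "e \<in> edges (CCC G)"
  proof cases
    case inner
    then obtain c d where e: "e = {c, d}" "c \<noteq> d"
      by (auto simp: card_2_iff)
    then have "c \<in> conj_class G ` inner" "d \<in> conj_class G ` inner"
      using inner by simp_all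
    then obtain a b where ab: "a \<in> inner" "b \<in> inner" and cd: "c = conj_class G a" "d = conj_class G b"
      by (elim imageE)
    have "a \<in> conj_class G a" "b \<in> conj_class G b" "a \<otimes> b = b \<otimes> a"
      using ab G.conj_class_refl commute_inner_iff[of b a] by simp_all
    then have "\<exists>a'\<in>conj_class G a. \<exists>b'\<in>conj_class G b. a' \<otimes> b' = b' \<otimes> a'"
      by (intro bexI)
    moreover have "a \<in> carrier G - center G" "b \<in> carrier G - center G"
      using ab by simp_all
    ultimately show ?thesis
      using e unfolding cd mem_edges_CCC by (intro exI conjI)
  next
    case outer
    then obtain c d where e: "e = {c, d}" "c \<noteq> d"
      by (auto simp: card_2_iff)
    then have "c \<in> conj_class G ` outer" "d \<in> conj_class G ` outer"
      using outer by simp_all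
    then obtain a b where ab: "a \<in> outer" "b \<in> outer" and cd: "c = conj_class G a" "d = conj_class G b"
      by (elim imageE)
    have "a \<in> carrier G - center G" "b \<in> carrier G - center G"
      using ab noncentral by simp_all
    then show ?thesis
      using e commuting_outer[OF ab] unfolding cd mem_edges_CCC by (intro exI conjI)
  qed
qed

lemma two_cliques_CCC: "two_cliques (CCC G) (conj_class G ` inner) (conj_class G ` outer)"
proof
  show "conj_class G ` inner \<inter> conj_class G ` outer = {}"
  proof (rule ccontr)
    assume "conj_class G ` inner \<inter> conj_class G ` outer \<noteq> {}"
    then obtain a b where ab: "a \<in> inner" "b \<in> outer" "conj_class G a = conj_class G b"
      by blast
    then have "b \<in> conj_class G a"
      using G.conj_class_refl by blast
    then show False
      using ab conj_class_inner by blast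
  qed
  have "vertices (CCC G) = conj_class G ` (carrier G - center G)"
    by (auto simp: CCC_def)
  then show "vertices (CCC G) = conj_class G ` inner \<union> conj_class G ` outer"
    by (simp only: image_Un[symmetric] noncentral[symmetric])
qed (simp_all add: finite_carrier edges_CCC)

end

text \<open>The left side is the sum of \<open>n * (n - 1) ^ 2\<close> over the clique sizes
  \<open>n = x * (q - 1) / p\<close> and \<open>n = x * (p - 1)\<close>, with the factor
  \<open>x / p ^ 3\<close> taken out.\<close>

lemma zagreb1_polynomial:
  fixes p q x :: real
  shows "(q - 1) * (x * (q - 1) - p) ^ 2 + p ^ 3 * (p - 1) * (x * (p - 1) - 1) ^ 2 =
    q^3 * x^2 - 3 * q^2 * x^2 + 3 * q * x^2 + p^6 * x^2
    - 3 * p^5 * x^2 + 3 * p^4 * x^2 - p^3 * x^2 - x^2 - 2 * p * q^2 * x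
    + 4 * p * q * x - 2 * p^5 * x + 4 * p^4 * x - 2 * p^3 * x
    - 2 * p * x + p^2 * q + p^4 - p^3 - p^2"
  by (simp add: algebra_simps eval_nat_numeral)

text \<open>Likewise for the sum of \<open>n * (n - 1) ^ 3\<close>, with \<open>x / p ^ 4\<close>
  taken out; this sum is twice the second index.\<close>

lemma zagreb2_polynomial:
  fixes p q x :: real
  shows "(q - 1) * (x * (q - 1) - p) ^ 3 + p ^ 4 * (p - 1) * (x * (p - 1) - 1) ^ 3 =
    q^4 * x^3 - 4 * q^3 * x^3 + 6 * q^2 * x^3 - 4 * q * x^3
    - p^3 * q - 4 * p^7 * x^3 + 6 * p^6 * x^3 - 4 * p^5 * x^3
    + 3 * p * x^2 + 3 * p^2 * q^2 * x - 3 * p * q^3 * x^2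
    + 9 * p * q^2 * x^2 - 9 * p * q * x^2 - 3 * p^7 * x^2
    + 9 * p^6 * x^2 - 9 * p^5 * x^2 + 3 * p^4 * x^2 + p^4 * x^3
    - 6 * p^2 * q * x + 3 * p^6 * x - 6 * p^5 * x + 3 * p^4 * x
    + 3 * p^2 * x + x^3 + p^8 * x^3 - p^5 + p^4 + p^3"
  by (simp add: algebra_simps eval_nat_numeral)

theorem theorem2p12:
  fixes G :: "('a, 'b) monoid_scheme" and p q x :: nat and f :: "int \<Rightarrow> int \<Rightarrow> int"
  assumes "prime p" and "prime q"
    and "group G" and "finite (carrier G)"
    and "f \<in> hom (integer_mod_group p) (AutoGroup (integer_mod_group q))"
    and "frobenius_group (semidirect (integer_mod_group q) (integer_mod_group p) f)
           (carrier (integer_mod_group q) \<times> {\<one>\<^bsub>integer_mod_group p\<^esub>})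
           ({\<one>\<^bsub>integer_mod_group q\<^esub>} \<times> carrier (integer_mod_group p))"
    and "G Mod center G \<cong> semidirect (integer_mod_group q) (integer_mod_group p) f"
    and "x = card (center G)"
  shows "(real (zagreb1 (CCC G)) =
      real x / real p^3 *
         (real q^3 * real x^2 - 3 * real q^2 * real x^2 + 3 * real q * real x^2 + real p^6 * real x^2
          - 3 * real p^5 * real x^2 + 3 * real p^4 * real x^2 - real p^3 * real x^2 - real x^2 - 2 * real p * real q^2 * real x
          + 4 * real p * real q * real x - 2 * real p^5 * real x + 4 * real p^4 * real x - 2 * real p^3 * real x
          - 2 * real p * real x + real p^2 * real q + real p^4 - real p^3 - real p^2))
    \<and> (real (zagreb2 (CCC G)) =
      real x / (2 * real p^4) *
         (real q^4 * real x^3 - 4 * real q^3 * real x^3 + 6 * real q^2 * real x^3 - 4 * real q * real x^3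
          - real p^3 * real q - 4 * real p^7 * real x^3 + 6 * real p^6 * real x^3 - 4 * real p^5 * real x^3
          + 3 * real p * real x^2 + 3 * real p^2 * real q^2 * real x - 3 * real p * real q^3 * real x^2
          + 9 * real p * real q^2 * real x^2 - 9 * real p * real q * real x^2 - 3 * real p^7 * real x^2
          + 9 * real p^6 * real x^2 - 9 * real p^5 * real x^2 + 3 * real p^4 * real x^2 + real p^4 * real x^3
          - 6 * real p^2 * real q * real x + 3 * real p^6 * real x - 6 * real p^5 * real x + 3 * real p^4 * real x
          + 3 * real p^2 * real x + real x^3 + real p^8 * real x^3 - real p^5 + real p^4 + real p^3))
    \<and> (real (zagreb2 (CCC G)) / real (card (edges (CCC G)))
       \<ge> real (zagreb1 (CCC G)) / real (card (vertices (CCC G))))"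
proof -
  let ?Zq = "integer_mod_group q" and ?Zp = "integer_mod_group p" and ?Z = "center G"
  let ?F = "semidirect ?Zq ?Zp f"
  interpret G: group G by fact
  interpret Z: normal "center G" G by (rule G.normal_center)
  have F: "group ?F"
    by (rule group_semidirect) (use assms(5) in auto)
  have pq: "0 < p" "0 < q"
    using assms(1,2) prime_gt_0_nat by auto
  obtain \<phi> where \<phi>: "\<phi> \<in> iso (G Mod ?Z) ?F"
    using assms(7) by (auto simp: is_iso_def)
  define \<pi> where "\<pi> = (\<lambda>g. \<phi> (?Z #>\<^bsub>G\<^esub> g))"
  have coset: "(\<lambda>g. ?Z #>\<^bsub>G\<^esub> g) \<in> hom G (G Mod ?Z)"
    by (rule Z.r_coset_hom_Mod)
  have bij: "bij_betw \<phi> (carrier (G Mod ?Z)) (carrier ?F)" and hom: "\<phi> \<in> hom (G Mod ?Z) ?F"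
    using \<phi> by (auto simp: iso_def)
  have "\<pi> \<in> hom G ?F"
    using hom_compose[OF coset hom] by (simp add: \<pi>_def comp_def)
  then interpret \<pi>: group_hom G ?F \<pi>
    using F by (simp add: group_hom_def group_hom_axioms_def assms(3))
  have surj: "\<pi> ` carrier G = carrier ?F"
    using bij by (auto simp: \<pi>_def bij_betw_def carrier_FactGroup image_image)
  have kernel: "kernel G ?F \<pi> = ?Z"
  proof (intro subset_antisym subsetI)
    fix a assume "a \<in> kernel G ?F \<pi>"
    then have a: "a \<in> carrier G" "\<phi> (?Z #>\<^bsub>G\<^esub> a) = \<phi> (?Z #>\<^bsub>G\<^esub> \<one>\<^bsub>G\<^esub>)"
      using \<pi>.hom_one by (auto simp: kernel_def \<pi>_def)
    \<comment> \<open>Injectivity of \<open>\<phi>\<close> on cosets shows that the coset of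
      \<open>a\<close> is the center itself.\<close>
    then have "?Z #>\<^bsub>G\<^esub> a = ?Z #>\<^bsub>G\<^esub> \<one>\<^bsub>G\<^esub>"
      using bij by (auto simp: bij_betw_def carrier_FactGroup dest: inj_onD)
    then show "a \<in> ?Z"
      using G.rcos_self[OF a(1) Z.subgroup_axioms] Z.subset by (simp add: G.coset_mult_one)
  next
    fix a assume a: "a \<in> ?Z"
    then have "\<pi> a = \<pi> \<one>\<^bsub>G\<^esub>"
      using Z.rcos_const Z.subset by (simp add: \<pi>_def G.coset_mult_one)
    then show "a \<in> kernel G ?F \<pi>"
      using a Z.subset by (auto simp: kernel_def)
  qed
  interpret K: normal "carrier ?Zq \<times> {\<one>\<^bsub>?Zp\<^esub>}" ?F
    by (rule normal_kernel_semidirect) (use assms(5) in auto)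
  have order: "order ?F = q * p"
    using pq by (simp add: order_def semidirect_def carrier_integer_mod_group card_cartesian_product)
  interpret frobenius_central_quotient G ?F \<pi>
    "carrier ?Zq \<times> {\<one>\<^bsub>?Zp\<^esub>}" "{\<one>\<^bsub>?Zq\<^esub>} \<times> carrier ?Zp" p q
    by unfold_locales (use assms(1,2,4,6) pq surj kernel order in
      \<open>simp_all add: carrier_integer_mod_group card_cartesian_product\<close>)
  let ?V = "conj_class G ` inner" and ?W = "conj_class G ` outer"
  interpret two_cliques "CCC G" ?V ?W
    by (rule two_cliques_CCC)
  have "finite ?Z"
    using Z.subset finite_carrier by (rule finite_subset)
  then have x: "0 < x"
    using assms(8) Z.one_closed by (metis card_gt_0_iff empty_iff)
  have "1 < p" "1 < q"
    using assms(1,2) prime_gt_1_nat by auto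
  \<comment> \<open>The numbers \<open>x\<close>, \<open>p - 1\<close> and \<open>q - 1\<close> are
    positive, so neither clique is empty, as \<open>zagreb_quotients\<close> requires.\<close>
  then have "card ?V > 0" "card ?W > 0"
    using card_inner_classes card_outer_classes x assms(8) by (auto intro!: gr0I)
  then have "?V \<noteq> {}" "?W \<noteq> {}"
    by (metis card.empty less_irrefl)+
  then have quotients: "real (zagreb2 (CCC G)) / real (card (edges (CCC G)))
       \<ge> real (zagreb1 (CCC G)) / real (card (vertices (CCC G)))"
    by (rule zagreb_quotients)
  have "real (p * card ?V) = real (x * (q - 1))"
    by (simp only: card_inner_classes assms(8))
  \<comment> \<open>Since \<open>q\<close> is positive, the truncated \<open>q - 1\<close> becomes
    the real difference.\<close>
  then have V: "real (card ?V) = real x * (real q - 1) / real p"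
    using pq by (simp add: Suc_le_eq field_simps)
  have "real (card ?W) = real (x * (p - 1))"
    by (simp only: card_outer_classes assms(8))
  then have W: "real (card ?W) = real x * (real p - 1)"
    using pq by (simp add: Suc_le_eq)
  have p: "real p \<noteq> 0"
    using pq by simp
  have m1: "real (zagreb1 (CCC G)) = real x / real p ^ 3 *
      ((real q - 1) * (real x * (real q - 1) - real p) ^ 2
        + real p ^ 3 * (real p - 1) * (real x * (real p - 1) - 1) ^ 2)"
    unfolding zagreb1 V W using p by (simp add: field_simps power2_eq_square power3_eq_cube)
  have "2 * real (zagreb2 (CCC G)) = real x / real p ^ 4 *
      ((real q - 1) * (real x * (real q - 1) - real p) ^ 3
        + real p ^ 4 * (real p - 1) * (real x * (real p - 1) - 1) ^ 3)"
    unfolding zagreb2 V W using p by (simp add: field_simps power4_eq_xxxx power3_eq_cube)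
  then have m2: "real (zagreb2 (CCC G)) = real x / (2 * real p ^ 4) *
      ((real q - 1) * (real x * (real q - 1) - real p) ^ 3
        + real p ^ 4 * (real p - 1) * (real x * (real p - 1) - 1) ^ 3)"
    using p by (simp add: divide_simps ac_simps)
  show ?thesis
    using m1 m2 quotients unfolding zagreb1_polynomial zagreb2_polynomial by (intro conjI)
qed

end
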